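(* Let $C$ be a linear $[n,k]$ code over the finite field $\mathbb{F}_q$ and let $f\in\mathrm{Harm}_d$ be a harmonic function of degree $d$. Then \[ Z_{C,f}(x,y)=(-1)^{d}(x-y)^{k-d}\,y^{n-k-d}\;T\!\left(M_C,f;\frac{x+(q-1)y}{x-y},\frac{x}{y}\right). \]
   Context: $E=\{1,\dots,n\}$ and $E_d$ is the set of $d$-element subsets of $E$. For $f:E_d\to\mathbb{R}$, $\widetilde f(X):=\sum_{Z\in E_d,\,Z\subset X}f(Z)$ for $X\subset E$. $\mathrm{Harm}_d$ is the set of $f:E_d\to\mathbb{R}$ with $\sum_{Z\in E_d,\,Z\supset Y}f(Z)=0$ for every $(d-1)$-subset $Y\subset E$. For $\mathbf u\in\mathbb{F}_q^n$, $\mathrm{supp}(\mathbf u)=\{i:u_i\ne0\}$, $\mathrm{wt}(\mathbf u)=|\mathrm{supp}(\mathbf u)|$, $\widetilde f(\mathbf u):=\widetilde f(\mathrm{supp}(\mathbf u))$. With $A_{i,f}:=\sum_{\mathbf u\in C,\,\mathrm{wt}(\mathbf u)=i}\widetilde f(\mathbf u)$, the harmonic weight enumerator is $W_{C,f}(x,y)=\sum_iA_{i,f}x^{n-i}y^i$ and $Z_{C,f}(x,y):=\sum_{i=0}^nA_{i,f}x^{n-i-d}y^{i-d}$ (so $W_{C,f}=(xy)^dZ_{C,f}$). $M_C$ is the matroid on $E$ whose independent sets are the index sets of linearly independent columns (over $\mathbb{F}_q$) of a generator matrix of $C$, with rank function $\rho$. The harmonic Tutte polynomial is $T(M,f;x,y):=\sum_{J\subset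 E}\widetilde f(J)(x-1)^{\rho(E)-\rho(J)}(y-1)^{|J|-\rho(J)}$. *)

theory Defs
  imports "Jordan_Normal_Form.VS_Connect"
begin

text \<open>
  The \<open>n\<close> coordinates are numbered \<open>0, \<dots>, n - 1\<close>, as are the entries of vectors and the columns
  of matrices in the library, so that \<open>E = {..<n}\<close>.

  A function on the \<open>d\<close>-subsets of \<open>E\<close> is represented by a total function on sets; its values
  outside the \<open>d\<close>-subsets of \<open>E\<close> are never used.
\<close>

definition d_subsets :: "'e set \<Rightarrow> nat \<Rightarrow> 'e set set" where
  "d_subsets E d = {Z. Z \<subseteq> E \<and> card Z = d}"

text \<open>The condition \<open>card Y + 1 = d\<close> says that \<open>Y\<close> is a \<open>(d - 1)\<close>-subset; for \<open>d = 0\<close> there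
  is none, so every function is harmonic of degree \<open>0\<close>.\<close>

definition Harm :: "'e set \<Rightarrow> nat \<Rightarrow> ('e set \<Rightarrow> real) set" where
  "Harm E d = {f. \<forall>Y. Y \<subseteq> E \<and> card Y + 1 = d \<longrightarrow>
                   (\<Sum>Z | Z \<in> d_subsets E d \<and> Y \<subseteq> Z. f Z) = 0}"

definition tilde :: "'e set \<Rightarrow> nat \<Rightarrow> ('e set \<Rightarrow> real) \<Rightarrow> 'e set \<Rightarrow> real" where
  "tilde E d f X = (\<Sum>Z | Z \<in> d_subsets E d \<and> Z \<subseteq> X. f Z)"

definition supp :: "'a::zero vec \<Rightarrow> nat set" where
  "supp u = {i. i < dim_vec u \<and> u $ i \<noteq> 0}"

definition wt :: "'a::zero vec \<Rightarrow> nat" where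
  "wt u = card (supp u)"

definition linear_code :: "nat \<Rightarrow> nat \<Rightarrow> 'a::{field,finite} vec set \<Rightarrow> bool" where
  "linear_code n k C \<longleftrightarrow>
     subspace class_ring C (module_vec TYPE('a) n) \<and>
     vectorspace.dim class_ring ((module_vec TYPE('a) n)\<lparr>carrier := C\<rparr>) = k"

definition generator_matrix :: "nat \<Rightarrow> nat \<Rightarrow> 'a::{field,finite} vec set \<Rightarrow> 'a mat \<Rightarrow> bool" where
  "generator_matrix n k C G \<longleftrightarrow>
     G \<in> carrier_mat k n \<and>
     distinct (rows G) \<and>
     \<not> module.lin_dep class_ring (module_vec TYPE('a) n) (set (rows G)) \<and>
     vec_space.row_space n G = C"

definition coeff_A :: "nat \<Rightarrow> nat \<Rightarrow> 'a::{field,finite} vec set \<Rightarrow> (nat set \<Rightarrow> real) \<Rightarrow> nat \<Rightarrow> real" where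
  "coeff_A n d C f i = (\<Sum>u | u \<in> C \<and> wt u = i. tilde {..<n} d f (supp u))"

text \<open>The exponents are integers and may be negative. The arguments range over an arbitrary field
  extending the reals, for instance the field of rational functions in two indeterminates.\<close>

definition Z_enum ::
  "nat \<Rightarrow> nat \<Rightarrow> 'a::{field,finite} vec set \<Rightarrow> (nat set \<Rightarrow> real) \<Rightarrow> 'b::real_field \<Rightarrow> 'b \<Rightarrow> 'b" where
  "Z_enum n d C f x y =
     (\<Sum>i = 0..n. of_real (coeff_A n d C f i) *
        x powi (int n - int i - int d) * y powi (int i - int d))"

text \<open>A matroid is given by its ground set and its family of independent sets. The column matroid
  takes the columns as an indexed family: indices of equal columns are dependent.\<close>

definition column_indep :: "'a::field mat \<Rightarrow> nat set set" where
  "column_indep G = {J. J \<subseteq> {..<dim_col G} \<and> inj_on (col G) J \<and>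
     \<not> module.lin_dep class_ring (module_vec TYPE('a) (dim_row G)) (col G ` J)}"

definition matroid_rank :: "'e set set \<Rightarrow> 'e set \<Rightarrow> nat" where
  "matroid_rank \<I> J = Max (card ` {X. X \<in> \<I> \<and> X \<subseteq> J})"

text \<open>The natural-number subtractions in the exponents do not truncate, as the rank function is
  monotone and bounded by the cardinality.\<close>

definition harmonic_Tutte ::
  "'e set \<Rightarrow> 'e set set \<Rightarrow> nat \<Rightarrow> ('e set \<Rightarrow> real) \<Rightarrow> 'b::real_field \<Rightarrow> 'b \<Rightarrow> 'b" where
  "harmonic_Tutte E \<I> d f x y =
     (\<Sum>J \<in> Pow E. of_real (tilde E d f J) *
        (x - 1) ^ (matroid_rank \<I> E - matroid_rank \<I> J) *
        (y - 1) ^ (card J - matroid_rank \<I> J))"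

end

theory Submission
  imports Defs "Jordan_Normal_Form.DL_Rank" "HOL-Library.Cardinality"
begin

text \<open>
  Harmonicity forces all sums of \<open>f\<close> over the \<open>d\<close>-subsets containing a fixed smaller set to vanish,
  and inclusion-exclusion then turns this into \<open>tilde f (E - X) = (-1)^d tilde f X\<close>.

  After substitution the powers of \<open>q y\<close> in the Tutte sum leave a factor \<open>q^(k - \<rho>(J))\<close>,
  the number of codewords vanishing on \<open>J\<close>. Exchanging the sums
  over \<open>J\<close> and over codewords \<open>u\<close> leaves, for each \<open>u\<close> with zero set \<open>U = E - supp u\<close>, a sum
  over \<open>J \<subseteq> U\<close> that the binomial theorem evaluates to
  \<open>tilde f U x^(|U| - d) y^(n - |U| - d)\<close>.
\<close>

section \<open>Subset sums and harmonic functions\<close>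

text \<open>This is the product of \<open>card A\<close> equal factors \<open>a + b\<close>
  multiplied out, with \<open>Y\<close> recording the factors that contribute
  \<open>a\<close>.\<close>

lemma sum_Pow_binomial:
  fixes a b :: "'b::comm_ring_1"
  assumes "finite A"
  shows "(\<Sum>Y\<in>Pow A. a ^ card Y * b ^ (card A - card Y)) = (a + b) ^ card A"
  using assms
proof (induction A)
  case empty
  then show ?case by simp
next
  case (insert z A)
  let ?g = "\<lambda>Y. a ^ card Y * b ^ (card (insert z A) - card Y)"
  have fin: "finite Y" and le: "card Y \<le> card A" if "Y \<in> Pow A" for Y
    using that insert.hyps by (auto intro: finite_subset card_mono)
  have "(\<Sum>Y\<in>Pow (insert z A). ?g Y) = (\<Sum>Y\<in>Pow A. ?g Y) + (\<Sum>Y\<in>insert z ` Pow A. ?g Y)"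
    unfolding Pow_insert using insert.hyps by (intro sum.union_disjoint) auto
  also have "(\<Sum>Y\<in>insert z ` Pow A. ?g Y) = (\<Sum>Y\<in>Pow A. ?g (insert z Y))"
    by (rule sum.reindex_cong[OF _ refl refl]) (use insert.hyps in \<open>auto simp: inj_on_def\<close>)
  also have "\<dots> = (\<Sum>Y\<in>Pow A. a * (a ^ card Y * b ^ (card A - card Y)))"
  proof (rule sum.cong[OF refl])
    fix Y assume Y: "Y \<in> Pow A"
    then have "z \<notin> Y" using insert.hyps by auto
    then show "?g (insert z Y) = a * (a ^ card Y * b ^ (card A - card Y))"
      using fin[OF Y] insert.hyps by (simp add: mult.assoc)
  qed
  also have "(\<Sum>Y\<in>Pow A. ?g Y) = (\<Sum>Y\<in>Pow A. b * (a ^ card Y * b ^ (card A - card Y)))"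
    by (rule sum.cong[OF refl]) (use le insert.hyps in \<open>simp add: Suc_diff_le mult_ac\<close>)
  finally show ?case
    using insert by (simp add: sum_distrib_left[symmetric] algebra_simps)
qed

lemma finite_d_subsets: "finite E \<Longrightarrow> finite (d_subsets E d)"
  unfolding d_subsets_def by simp

text \<open>Downward induction on the size of \<open>Y\<close>, starting from the defining condition
  at size \<open>d - 1\<close>. Adding up the vanishing sums for all \<open>insert x Y\<close> with
  \<open>x\<close> outside \<open>Y\<close> counts each \<open>Z\<close> once per element of
  \<open>Z - Y\<close>, so \<open>d - card Y\<close> times, and this factor is nonzero.\<close>

lemma Harm_sum_superset_eq_0:
  assumes fin: "finite E" and f: "f \<in> Harm E d" and "Y \<subseteq> E" and "card Y < d"
  shows "(\<Sum>Z | Z \<in> d_subsets E d \<and> Y \<subseteq> Z. f Z) = 0"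
  using assms(3,4)
proof (induction "d - card Y" arbitrary: Y rule: less_induct)
  case less
  show ?case
  proof (cases "card Y + 1 = d")
    case True
    then show ?thesis using f less.prems unfolding Harm_def by blast
  next
    case False
    let ?D = "{Z \<in> d_subsets E d. Y \<subseteq> Z}"
    have finY: "finite Y" using less.prems fin finite_subset by blast
    have "0 = (\<Sum>x\<in>E - Y. \<Sum>Z | Z \<in> d_subsets E d \<and> insert x Y \<subseteq> Z. f Z)"
    proof (rule sym, rule sum.neutral, rule ballI)
      fix x assume x: "x \<in> E - Y"
      then have "card (insert x Y) = card Y + 1" using finY by simp
      then show "(\<Sum>Z | Z \<in> d_subsets E d \<and> insert x Y \<subseteq> Z. f Z) = 0"
        using less False x by (intro less.hyps) auto
    qed
    also have "\<dots> = (\<Sum>x\<in>E - Y. \<Sum>Z | Z \<in> ?D \<and> x \<in> Z. f Z)"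
      by (intro sum.cong) auto
    also have "\<dots> = (\<Sum>Z\<in>?D. \<Sum>x | x \<in> E - Y \<and> x \<in> Z. f Z)"
      using fin finite_d_subsets[OF fin] by (intro sum.swap_restrict) auto
    also have "\<dots> = (\<Sum>Z\<in>?D. real (d - card Y) * f Z)"
    proof (rule sum.cong[OF refl])
      fix Z assume Z: "Z \<in> ?D"
      then have "{x. x \<in> E - Y \<and> x \<in> Z} = Z - Y"
        by (auto simp: d_subsets_def)
      moreover have "card (Z - Y) = d - card Y"
        using Z finY by (simp add: card_Diff_subset d_subsets_def)
      ultimately show "(\<Sum>x | x \<in> E - Y \<and> x \<in> Z. f Z) = real (d - card Y) * f Z"
        by simp
    qed
    also have "\<dots> = real (d - card Y) * (\<Sum>Z\<in>?D. f Z)"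
      by (simp add: sum_distrib_left)
    finally show ?thesis using less.prems by simp
  qed
qed

text \<open>The condition that \<open>Z\<close> avoids \<open>X\<close> is expressed by an
  alternating sum over the common subsets \<open>Y\<close> of \<open>X\<close> and \<open>Z\<close>.
  After the sums are exchanged only \<open>Y\<close> of size \<open>d\<close> survive: smaller ones
  vanish by harmonicity, and larger ones lie in no \<open>d\<close>-subset.\<close>

lemma tilde_Diff:
  assumes fin: "finite E" and f: "f \<in> Harm E d" and X: "X \<subseteq> E"
  shows "tilde E d f (E - X) = (-1) ^ d * tilde E d f X"
proof -
  let ?s = "\<lambda>Y. \<Sum>Z | Z \<in> d_subsets E d \<and> Y \<subseteq> Z. f Z"
  have finX: "finite X" using X fin finite_subset by blast
  have "tilde E d f (E - X) = (\<Sum>Z\<in>d_subsets E d. if Z \<subseteq> E - X then f Z else 0)"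
    unfolding tilde_def using finite_d_subsets[OF fin] by (simp add: sum.inter_filter)
  also have "\<dots> = (\<Sum>Z\<in>d_subsets E d. \<Sum>Y | Y \<in> Pow X \<and> Y \<subseteq> Z. (-1) ^ card Y * f Z)"
  proof (rule sum.cong[OF refl])
    fix Z assume Z: "Z \<in> d_subsets E d"
    have "{Y. Y \<in> Pow X \<and> Y \<subseteq> Z} = Pow (X \<inter> Z)" by auto
    \<comment> \<open>A power of zero serves as the indicator: it is \<open>1\<close> for exponent
      \<open>0\<close>, that is, when \<open>X\<close> and \<open>Z\<close> are disjoint, and
      \<open>0\<close> otherwise.\<close>
    moreover have "(\<Sum>Y\<in>Pow (X \<inter> Z). (-1) ^ card Y) = (0::real) ^ card (X \<inter> Z)"
      using sum_Pow_binomial[of "X \<inter> Z" "-1::real" 1] finX by simp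
    moreover have "X \<inter> Z = {} \<longleftrightarrow> Z \<subseteq> E - X"
      using Z by (auto simp: d_subsets_def)
    ultimately show "(if Z \<subseteq> E - X then f Z else 0) =
        (\<Sum>Y | Y \<in> Pow X \<and> Y \<subseteq> Z. (-1) ^ card Y * f Z)"
      using finX by (simp add: sum_distrib_right[symmetric] power_0_left)
  qed
  also have "\<dots> = (\<Sum>Y\<in>Pow X. \<Sum>Z | Z \<in> d_subsets E d \<and> Y \<subseteq> Z. (-1) ^ card Y * f Z)"
    using finX finite_d_subsets[OF fin] by (intro sum.swap_restrict[symmetric]) auto
  also have "\<dots> = (\<Sum>Y\<in>Pow X. (-1) ^ card Y * ?s Y)"
    by (simp add: sum_distrib_left)
  also have "\<dots> = (\<Sum>Y | Y \<in> d_subsets E d \<and> Y \<subseteq> X. (-1) ^ card Y * ?s Y)"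
  proof (rule sum.mono_neutral_right)
    show "\<forall>Y \<in> Pow X - {Y. Y \<in> d_subsets E d \<and> Y \<subseteq> X}. (-1) ^ card Y * ?s Y = 0"
    proof
      fix Y assume Y: "Y \<in> Pow X - {Y. Y \<in> d_subsets E d \<and> Y \<subseteq> X}"
      show "(-1) ^ card Y * ?s Y = 0"
      proof (cases "card Y < d")
        case True
        then show ?thesis using Harm_sum_superset_eq_0[OF fin f, of Y] X Y by auto
      next
        case False
        then have "d < card Y" using Y X by (auto simp: d_subsets_def)
        then have "{Z. Z \<in> d_subsets E d \<and> Y \<subseteq> Z} = {}"
          using fin by (auto simp: d_subsets_def) (meson card_mono finite_subset not_less)
        then show ?thesis by (simp only: sum.empty mult_zero_right)
      qed
    qed
  qed (use finX in auto)
  also have "\<dots> = (\<Sum>Y | Y \<in> d_subsets E d \<and> Y \<subseteq> X. (-1) ^ d * f Y)"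
  proof (rule sum.cong[OF refl])
    fix Y assume "Y \<in> {Y. Y \<in> d_subsets E d \<and> Y \<subseteq> X}"
    then have Y: "Y \<subseteq> E" "card Y = d" by (auto simp: d_subsets_def)
    \<comment> \<open>At equal finite cardinality, inclusion is equality.\<close>
    then have "{Z. Z \<in> d_subsets E d \<and> Y \<subseteq> Z} = {Y}"
      using fin by (auto simp: d_subsets_def) (metis card_subset_eq finite_subset)+
    then show "(-1) ^ card Y * ?s Y = (-1) ^ d * f Y" using Y by simp
  qed
  finally show ?thesis by (simp add: tilde_def sum_distrib_left)
qed

text \<open>With \<open>tilde\<close> expanded and the sums exchanged, each \<open>d\<close>-subset
  \<open>Z\<close> of \<open>U\<close> is summed over its supersets \<open>J = Z \<union> K\<close>
  in \<open>U\<close>. The set \<open>K\<close> ranges freely over subsets of \<open>U - Z\<close>,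
  so the binomial theorem with \<open>(x - y) + y = x\<close> applies.\<close>

lemma sum_Pow_tilde:
  fixes x y :: "'b::real_field"
  assumes fin: "finite E" and U: "U \<subseteq> E" and y: "y \<noteq> 0"
  shows "(\<Sum>J\<in>Pow U. of_real (tilde E d f J) *
           ((x - y) powi (int (card J) - int d) * y powi (int n - int (card J) - int d))) =
         of_real (tilde E d f U) * (x powi (int (card U) - int d) * y powi (int n - int (card U) - int d))"
proof -
  let ?g = "\<lambda>J. (x - y) powi (int (card J) - int d) * y powi (int n - int (card J) - int d)"
  let ?h = "x powi (int (card U) - int d) * y powi (int n - int (card U) - int d)"
  have finU: "finite U" using U fin finite_subset by blast
  have inner: "(\<Sum>J | J \<in> Pow U \<and> Z \<subseteq> J. ?g J) = (if Z \<subseteq> U then ?h else 0)"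
    if Z: "Z \<in> d_subsets E d" for Z
  proof (cases "Z \<subseteq> U")
    case False
    then have "{J. J \<in> Pow U \<and> Z \<subseteq> J} = {}" by auto
    then show ?thesis using False by (simp only: sum.empty if_False)
  next
    case True
    have cZ: "card Z = d" using Z by (simp add: d_subsets_def)
    have finZ: "finite Z" using True finU finite_subset by blast
    \<comment> \<open>This makes the exponent of \<open>x\<close> a natural number, so that the
      power produced by the binomial theorem agrees with \<open>powi\<close>.\<close>
    have dle: "d \<le> card U" using True cZ finU card_mono by blast
    let ?W = "U - Z"
    have cW: "card ?W = card U - d" using True cZ finZ by (simp add: card_Diff_subset)
    have "(\<Sum>J | J \<in> Pow U \<and> Z \<subseteq> J. ?g J) = (\<Sum>K\<in>Pow ?W. ?g (Z \<union> K))"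
      by (rule sum.reindex_bij_witness[of _ "\<lambda>K. Z \<union> K" "\<lambda>J. J - Z"])
         (use True in \<open>auto simp: Un_absorb1\<close>)
    also have "\<dots> = (\<Sum>K\<in>Pow ?W. y powi (int n - int (card U) - int d) *
                      ((x - y) ^ card K * y ^ (card ?W - card K)))"
    proof (rule sum.cong[OF refl])
      fix K assume K: "K \<in> Pow ?W"
      then have cK: "card K \<le> card ?W" using finU by (auto intro: card_mono)
      have cJ: "card (Z \<union> K) = d + card K"
        using K finU finZ cZ by (subst card_Un_disjoint) (auto intro: finite_subset)
      \<comment> \<open>The exponent of \<open>y\<close> at \<open>J\<close> exceeds the one at
        \<open>U\<close> by the number of elements of \<open>U\<close> missing from
        \<open>J\<close>.\<close>
      have "y powi (int n - int (d + card K) - int d) =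
          y powi ((int n - int (card U) - int d) + int (card ?W - card K))"
        using cK cW dle by (simp add: algebra_simps of_nat_diff)
      then show "?g (Z \<union> K) = y powi (int n - int (card U) - int d) *
            ((x - y) ^ card K * y ^ (card ?W - card K))"
        unfolding cJ using y by (simp add: power_int_add)
    qed
    also have "\<dots> = y powi (int n - int (card U) - int d) * x ^ card ?W"
      using sum_Pow_binomial[of ?W "x - y" y] finU by (simp add: sum_distrib_left[symmetric])
    also have "x ^ card ?W = x powi (int (card U) - int d)"
      using dle unfolding cW by (simp flip: of_nat_diff)
    finally show ?thesis using True by simp
  qed
  have "(\<Sum>J\<in>Pow U. of_real (tilde E d f J) * ?g J) =
      (\<Sum>J\<in>Pow U. \<Sum>Z | Z \<in> d_subsets E d \<and> Z \<subseteq> J. of_real (f Z) * ?g J)"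
    by (simp add: tilde_def sum_distrib_right)
  also have "\<dots> = (\<Sum>Z\<in>d_subsets E d. \<Sum>J | J \<in> Pow U \<and> Z \<subseteq> J. of_real (f Z) * ?g J)"
    using finU finite_d_subsets[OF fin] by (intro sum.swap_restrict) auto
  also have "\<dots> = (\<Sum>Z\<in>d_subsets E d. of_real (f Z) * (if Z \<subseteq> U then ?h else 0))"
    by (intro sum.cong refl) (simp only: sum_distrib_left[symmetric] inner)
  also have "\<dots> = (\<Sum>Z | Z \<in> d_subsets E d \<and> Z \<subseteq> U. of_real (f Z) * ?h)"
    using finite_d_subsets[OF fin] by (simp add: sum.inter_filter if_distrib cong: if_cong)
  also have "\<dots> = of_real (tilde E d f U) * ?h"
    by (simp add: tilde_def sum_distrib_right)
  finally show ?thesis .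
qed

section \<open>Counting vectors orthogonal to a given family\<close>

lemma card_carrier_vec_prefix_0:
  assumes "m \<le> k"
  shows "card {z \<in> carrier_vec k :: 'a::{zero,finite} vec set. \<forall>i<m. z $ i = 0}
       = CARD('a) ^ (k - m)" (is "card ?S = _")
proof -
  let ?P = "{m..<k} \<rightarrow>\<^sub>E (UNIV :: 'a set)"
  have "bij_betw (\<lambda>g. vec k (\<lambda>i. if i < m then 0 else g i)) ?P ?S"
  proof (rule bij_betw_byWitness[where f' = "\<lambda>z. \<lambda>i\<in>{m..<k}. z $ i"])
    show "\<forall>g\<in>?P. (\<lambda>i\<in>{m..<k}. vec k (\<lambda>i. if i < m then 0 else g i) $ i) = g"
      by (auto simp: fun_eq_iff PiE_def extensional_def)
    show "\<forall>z\<in>?S. vec k (\<lambda>i. if i < m then 0 else (\<lambda>i\<in>{m..<k}. z $ i) i) = z"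
      by (auto intro!: eq_vecI)
  qed (use assms in auto)
  then have "card ?S = card ?P" by (simp add: bij_betw_same_card)
  then show ?thesis by (simp add: card_PiE)
qed

lemma finite_carrier_vec: "finite (carrier_vec k :: 'a::{zero,finite} vec set)"
  \<comment> \<open>For \<open>m = 0\<close> the prefix condition is empty, and a positive
    cardinality implies finiteness.\<close>
  using card_carrier_vec_prefix_0[of 0 k, where 'a = 'a] by (intro card_ge_0_finite) simp

lemma inj_on_mult_mat_vec:
  fixes A :: "'a::ring mat"
  assumes A: "A \<in> carrier_mat nr nc"
    and ker: "\<And>v. v \<in> carrier_vec nc \<Longrightarrow> A *\<^sub>v v = 0\<^sub>v nr \<Longrightarrow> v = 0\<^sub>v nc"
  shows "inj_on ((*\<^sub>v) A) (carrier_vec nc)"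
proof (rule inj_onI)
  fix v w assume v: "v \<in> carrier_vec nc" and w: "w \<in> carrier_vec nc" and eq: "A *\<^sub>v v = A *\<^sub>v w"
  have "A *\<^sub>v (v - w) = 0\<^sub>v nr"
    using A v w by (simp add: mult_minus_distrib_mat_vec eq)
  then have "v - w = 0\<^sub>v nc" using v w by (intro ker) auto
  show "v = w"
  proof (rule eq_vecI)
    fix i assume i: "i < dim_vec w"
    then have "(v - w) $ i = 0" using \<open>v - w = 0\<^sub>v nc\<close> w by simp
    then show "v $ i = w $ i" using i by simp
  qed (use v w in simp)
qed

text \<open>Extending \<open>B\<close> to a basis gives an invertible matrix that maps the vectors orthogonal to \<open>B\<close>
  onto those whose first \<open>card B\<close> entries vanish.\<close>

lemma card_orthogonal_lin_indpt:
  fixes B :: "'a::{field,finite} vec set"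
  assumes B: "B \<subseteq> carrier_vec k"
    and indep: "\<not> module.lin_dep class_ring (module_vec TYPE('a) k) B"
  shows "card {w \<in> carrier_vec k. \<forall>b\<in>B. w \<bullet> b = 0} = CARD('a) ^ (k - card B)"
    and "card B \<le> k"
proof -
  interpret vec_space "TYPE('a)" k .
  obtain D where D: "finite D" "maximal D (\<lambda>S. S \<subseteq> carrier_vec k \<and> lin_indpt S)" and BD: "B \<subseteq> D"
    using maximal_exists_superset[of "carrier_vec k" "\<lambda>S. S \<subseteq> carrier_vec k \<and> lin_indpt S" B]
      finite_carrier_vec B indep by blast
  have Dc: "D \<subseteq> carrier_vec k" and Dindep: "lin_indpt D"
    using D(2) by (auto simp: maximal_def)
  have cD: "card D = k"
    using dim_basis[OF D(1) max_li_is_basis] D(2) dim_is_n by simp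
  have finB: "finite B" by (rule finite_subset[OF BD D(1)])
  obtain bs where bs: "set bs = B" "distinct bs" using finite_distinct_list[OF finB] by metis
  obtain cs where cs: "set cs = D - B" "distinct cs" using finite_distinct_list[OF finite_Diff[OF D(1)]] by metis
  \<comment> \<open>Listing \<open>B\<close> first makes its vectors the first \<open>card B\<close>
    rows of \<open>M\<close>, so orthogonality to \<open>B\<close> becomes a condition on a prefix
    of the image.\<close>
  define ws where "ws = bs @ cs"
  have ws: "set ws = D" "distinct ws" using bs cs BD by (auto simp: ws_def)
  have len: "length ws = k" using distinct_card[OF ws(2)] ws(1) cD by simp
  have lenb: "length bs = card B" using distinct_card[OF bs(2)] bs(1) by simp
  show le: "card B \<le> k" using lenb len by (simp add: ws_def)
  define M where "M = mat_of_rows k ws"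
  have M: "M \<in> carrier_mat k k"
    using mat_of_rows_carrier(1)[of k ws] unfolding M_def len .
  \<comment> \<open>Passing to the transpose turns the basis into columns, the form in which the
    full rank criterion is available.\<close>
  have cols: "cols M\<^sup>T = ws" using ws(1) Dc by (simp add: M_def)
  have Mt: "M\<^sup>T \<in> carrier_mat k k" using M by simp
  have "rank M\<^sup>T = k"
    using lin_indpt_full_rank[OF Mt] ws Dindep unfolding cols by simp
  then have "det M \<noteq> 0" using det_rank_iff[OF Mt] det_transpose[OF M] by simp
  then have inj: "inj_on ((*\<^sub>v) M) (carrier_vec k)"
    using det_0_iff_vec_prod_zero_field[OF M] M by (intro inj_on_mult_mat_vec) auto
  have surj: "(*\<^sub>v) M ` carrier_vec k = carrier_vec k"
    using M finite_carrier_vec inj by (intro endo_inj_surj) auto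
  have index: "(M *\<^sub>v w) $ i = w \<bullet> ws ! i" if "i < k" "w \<in> carrier_vec k" for i w
  proof -
    have "ws ! i \<in> carrier_vec k" using nth_mem[of i ws] that(1) ws(1) Dc len by auto
    moreover from this have "(M *\<^sub>v w) $ i = ws ! i \<bullet> w" using that(1) len by (simp add: M_def)
    ultimately show ?thesis using comm_scalar_prod[OF _ that(2)] by simp
  qed
  let ?S = "{w \<in> carrier_vec k. \<forall>b\<in>B. w \<bullet> b = 0}"
  let ?T = "{z \<in> carrier_vec k :: 'a vec set. \<forall>i<card B. z $ i = 0}"
  have iff: "M *\<^sub>v w \<in> ?T \<longleftrightarrow> w \<in> ?S" if w: "w \<in> carrier_vec k" for w
  proof -
    have "(\<forall>b\<in>B. w \<bullet> b = 0) \<longleftrightarrow> (\<forall>i<card B. w \<bullet> bs ! i = 0)"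
      using all_set_conv_all_nth[of bs "\<lambda>b. w \<bullet> b = 0"] unfolding bs(1) lenb .
    moreover have "w \<bullet> bs ! i = (M *\<^sub>v w) $ i" if "i < card B" for i
    proof -
      have "ws ! i = bs ! i" using that lenb by (simp add: ws_def nth_append)
      moreover have "i < k" using that le by linarith
      ultimately show ?thesis using index[OF _ w, of i] by (simp only:)
    qed
    moreover have "M *\<^sub>v w \<in> carrier_vec k" using M w by simp
    ultimately show ?thesis using w by simp
  qed
  have "(*\<^sub>v) M ` ?S = ?T"
  proof (intro equalityI subsetI)
    fix z assume z: "z \<in> ?T"
    then have "z \<in> (*\<^sub>v) M ` carrier_vec k" unfolding surj by simp
    then obtain w where w: "w \<in> carrier_vec k" "z = M *\<^sub>v w" by (rule imageE)
    then have "w \<in> ?S" using z iff[OF w(1)] by simp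
    then show "z \<in> (*\<^sub>v) M ` ?S" using w(2) by (rule rev_image_eqI)
  next
    fix z assume "z \<in> (*\<^sub>v) M ` ?S"
    then obtain w where w: "w \<in> ?S" "z = M *\<^sub>v w" by (rule imageE)
    then show "z \<in> ?T" using iff[of w] by simp
  qed
  moreover have "inj_on ((*\<^sub>v) M) ?S" using inj by (rule inj_on_subset) auto
  ultimately have "bij_betw ((*\<^sub>v) M) ?S ?T" by (simp only: bij_betw_def simp_thms)
  then have "card ?S = card ?T" by (rule bij_betw_same_card)
  then show "card ?S = CARD('a) ^ (k - card B)"
    using card_carrier_vec_prefix_0[OF le, where 'a = 'a] by simp
qed

text \<open>This reduces orthogonality to a whole family of columns to orthogonality to an
  independent subfamily that spans it.\<close>

lemma orthogonal_span:
  fixes S :: "'a::field vec set"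
  assumes S: "S \<subseteq> carrier_vec k" and w: "w \<in> carrier_vec k" "\<forall>b\<in>S. w \<bullet> b = 0"
    and v: "v \<in> LinearCombinations.module.span class_ring (module_vec TYPE('a) k) S"
  shows "w \<bullet> v = 0"
proof -
  interpret vec_space "TYPE('a)" k .
  have "w \<in> orthogonal_complement (span S)"
    using w in_orthogonal_complement_span[OF S] by (simp add: orthogonal_complement_def)
  then show ?thesis using v by (simp add: orthogonal_complement_def)
qed

section \<open>Rank in the column matroid\<close>

lemma matroid_rank_witness:
  assumes "finite J" and "{} \<in> \<I>"
  obtains B where "B \<in> \<I>" "B \<subseteq> J" "card B = matroid_rank \<I> J"
    and "\<And>X. X \<in> \<I> \<Longrightarrow> X \<subseteq> J \<Longrightarrow> card X \<le> card B"
proof -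
  let ?S = "card ` {X. X \<in> \<I> \<and> X \<subseteq> J}"
  have fin: "finite ?S" using assms(1) by simp
  \<comment> \<open>The maximum is attained because the family contains the empty set.\<close>
  have "matroid_rank \<I> J \<in> ?S"
    unfolding matroid_rank_def using assms by (intro Max_in[OF fin]) auto
  then obtain B where B: "B \<in> \<I>" "B \<subseteq> J" "card B = matroid_rank \<I> J" by force
  moreover have "card X \<le> card B" if "X \<in> \<I>" "X \<subseteq> J" for X
    unfolding B(3) matroid_rank_def using that by (intro Max_ge[OF fin]) auto
  ultimately show thesis using that by blast
qed

text \<open>A largest independent \<open>B\<close> inside \<open>J\<close> has columns spanning all
  columns indexed by \<open>J\<close>. Both index sets therefore impose the same orthogonality
  conditions, and the count for an independent set of \<open>r\<close> vectors applies.\<close>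

lemma card_orthogonal_columns:
  fixes G :: "'a::{field,finite} mat"
  assumes G: "G \<in> carrier_mat k n" and J: "J \<subseteq> {..<n}"
  defines "r \<equiv> matroid_rank (column_indep G) J"
  shows "card {w \<in> carrier_vec k. \<forall>j\<in>J. w \<bullet> col G j = 0} = CARD('a) ^ (k - r)"
    and "r \<le> k" and "r \<le> card J"
proof -
  interpret vec_space "TYPE('a)" k .
  have colc: "col G j \<in> carrier_vec k" for j using col_dim[of G j] G by simp
  have indep_def: "X \<in> column_indep G \<longleftrightarrow> X \<subseteq> {..<n} \<and> inj_on (col G) X \<and> lin_indpt (col G ` X)" for X
    using G by (auto simp: column_indep_def)
  have finJ: "finite J" using J finite_subset by blast
  have "{} \<in> column_indep G" by (simp add: indep_def lin_dep_def)
  then obtain B where B: "B \<in> column_indep G" "B \<subseteq> J" "card B = r"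
    and max: "\<And>X. X \<in> column_indep G \<Longrightarrow> X \<subseteq> J \<Longrightarrow> card X \<le> card B"
    unfolding r_def using matroid_rank_witness[OF finJ] by blast
  have Bc: "col G ` B \<subseteq> carrier_vec k" using colc by blast
  have Bi: "inj_on (col G) B" "lin_indpt (col G ` B)" using B(1) by (auto simp: indep_def)
  have finB: "finite B" using B(2) finJ finite_subset by blast
  have cB: "card (col G ` B) = r" using Bi(1) B(3) by (simp add: card_image)
  have in_span: "col G j \<in> span (col G ` B)" if j: "j \<in> J" for j
  proof (rule ccontr)
    assume nin: "col G j \<notin> span (col G ` B)"
    \<comment> \<open>A column outside the span differs from every column of \<open>B\<close>. This
      keeps \<open>col G\<close> injective on \<open>insert j B\<close>, as
      \<open>column_indep\<close> demands, and so leads to a contradiction with maximality.\<close>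
    then have nB: "col G j \<notin> col G ` B" using in_own_span[of "col G ` B"] Bc by auto
    then have "lin_indpt (col G ` insert j B)"
      using lin_dep_iff_in_span[of "col G ` B" "col G j"] nin Bc Bi(2) colc by auto
    then have "insert j B \<in> column_indep G"
      using B(1) Bi(1) nB j J by (auto simp: indep_def)
    then have "card (insert j B) \<le> card B" using max j B(2) by simp
    moreover have "j \<notin> B" using nB by blast
    ultimately show False using finB by simp
  qed
  have "(\<forall>j\<in>J. w \<bullet> col G j = 0) \<longleftrightarrow> (\<forall>b\<in>col G ` B. w \<bullet> b = 0)" if w: "w \<in> carrier_vec k" for w
  proof
    assume "\<forall>j\<in>J. w \<bullet> col G j = 0"
    then show "\<forall>b\<in>col G ` B. w \<bullet> b = 0" using B(2) by blast
  next
    assume "\<forall>b\<in>col G ` B. w \<bullet> b = 0"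
    from orthogonal_span[OF Bc w this in_span]
    show "\<forall>j\<in>J. w \<bullet> col G j = 0" by (rule ballI)
  qed
  then have "{w \<in> carrier_vec k. \<forall>j\<in>J. w \<bullet> col G j = 0} = {w \<in> carrier_vec k. \<forall>b\<in>col G ` B. w \<bullet> b = 0}"
    by (intro Collect_cong conj_cong refl)
  then show "card {w \<in> carrier_vec k. \<forall>j\<in>J. w \<bullet> col G j = 0} = CARD('a) ^ (k - r)" and "r \<le> k"
    using card_orthogonal_lin_indpt[OF Bc] Bi(2) cB by auto
  show "r \<le> card J" using B(2,3) finJ card_mono by blast
qed

section \<open>Codewords and generator matrices\<close>

text \<open>This is the encoding of messages of length \<open>k\<close>. It is injective because a
  nonzero kernel vector would be a linear dependence among the rows of \<open>G\<close>, and its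
  image is the row space.\<close>

lemma generator_matrix_bij_betw:
  fixes G :: "'a::{field,finite} mat"
  assumes gen: "generator_matrix n k C G"
  shows "bij_betw ((*\<^sub>v) G\<^sup>T) (carrier_vec k) C"
proof -
  interpret vec_space "TYPE('a)" n .
  have G: "G \<in> carrier_mat k n" and C: "row_space G = C"
    and indep: "distinct (cols G\<^sup>T)" "lin_indpt (set (cols G\<^sup>T))"
    using gen by (auto simp: generator_matrix_def)
  have Gt: "G\<^sup>T \<in> carrier_mat n k" using G by simp
  have "inj_on ((*\<^sub>v) G\<^sup>T) (carrier_vec k)"
    using lin_depI[OF Gt _ _ _ indep(1)] indep(2) by (intro inj_on_mult_mat_vec[OF Gt]) blast
  moreover have "(*\<^sub>v) G\<^sup>T ` carrier_vec k = C"
    unfolding C[symmetric] row_space_eq[OF G] using G Gt by auto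
  ultimately show ?thesis by (simp add: bij_betw_def)
qed

text \<open>Entry \<open>j\<close> of the codeword of a message \<open>w\<close> is the scalar
  product of \<open>w\<close> with column \<open>j\<close> of \<open>G\<close>. Vanishing on
  \<open>J\<close> is thus orthogonality of \<open>w\<close> to the columns indexed by
  \<open>J\<close>.\<close>

lemma card_codewords_vanishing:
  fixes G :: "'a::{field,finite} mat"
  assumes gen: "generator_matrix n k C G" and J: "J \<subseteq> {..<n}"
  shows "card {u \<in> C. supp u \<inter> J = {}} = CARD('a) ^ (k - matroid_rank (column_indep G) J)"
proof -
  have G: "G \<in> carrier_mat k n" using gen by (simp add: generator_matrix_def)
  have bij: "bij_betw ((*\<^sub>v) G\<^sup>T) (carrier_vec k) C" by (rule generator_matrix_bij_betw[OF gen])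
  have supp_iff: "supp (G\<^sup>T *\<^sub>v w) \<inter> J = {} \<longleftrightarrow> (\<forall>j\<in>J. w \<bullet> col G j = 0)" if "w \<in> carrier_vec k" for w
  proof -
    have "(G\<^sup>T *\<^sub>v w) $ j = w \<bullet> col G j" if "j \<in> J" for j
    proof -
      have "col G j \<in> carrier_vec k" using col_dim[of G j] G by simp
      moreover have "(G\<^sup>T *\<^sub>v w) $ j = col G j \<bullet> w" using \<open>j \<in> J\<close> J G by auto
      ultimately show ?thesis using comm_scalar_prod[OF _ \<open>w \<in> carrier_vec k\<close>] by simp
    qed
    then show ?thesis using G J by (auto simp: supp_def)
  qed
  have "bij_betw ((*\<^sub>v) G\<^sup>T) {w \<in> carrier_vec k. \<forall>j\<in>J. w \<bullet> col G j = 0} {u \<in> C. supp u \<inter> J = {}}"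
    using bij supp_iff unfolding bij_betw_def inj_on_def by blast
  then show ?thesis
    using card_orthogonal_columns(1)[OF G J] by (simp add: bij_betw_same_card)
qed

text \<open>Equality of row and column rank is obtained by counting: only the zero codeword vanishes
  on all coordinates, so \<open>CARD('a)\<close> to the power \<open>k - ?r\<close> is
  \<open>1\<close>.\<close>

lemma matroid_rank_generator_matrix:
  fixes G :: "'a::{field,finite} mat"
  assumes gen: "generator_matrix n k C G"
  shows "matroid_rank (column_indep G) {..<n} = k"
proof -
  let ?r = "matroid_rank (column_indep G) {..<n}"
  have G: "G \<in> carrier_mat k n" using gen by (simp add: generator_matrix_def)
  have bij: "bij_betw ((*\<^sub>v) G\<^sup>T) (carrier_vec k) C" by (rule generator_matrix_bij_betw[OF gen])
  have C: "C \<subseteq> carrier_vec n" using bij G by (auto simp: bij_betw_def)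
  have "G\<^sup>T *\<^sub>v 0\<^sub>v k = 0\<^sub>v n" using G by (intro eq_vecI) auto
  then have zero: "0\<^sub>v n \<in> C"
    using bij unfolding bij_betw_def by (metis image_eqI zero_carrier_vec)
  have "{u \<in> C. supp u \<inter> {..<n} = {}} = {0\<^sub>v n}"
  proof (intro equalityI subsetI)
    fix u assume u: "u \<in> {u \<in> C. supp u \<inter> {..<n} = {}}"
    then have "dim_vec u = n" using C by auto
    then show "u \<in> {0\<^sub>v n}" using u by (auto simp: supp_def intro!: eq_vecI)
  qed (use zero in \<open>auto simp: supp_def\<close>)
  then have "CARD('a) ^ (k - ?r) = 1"
    using card_codewords_vanishing[OF gen, of "{..<n}"] by simp
  moreover have "CARD('a) > 1"
    using card_mono[of UNIV "{0::'a, 1}"] by simp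
  ultimately have "k - ?r = 0" using nat_power_eq_Suc_0_iff by simp
  then show ?thesis using card_orthogonal_columns(2)[OF G, of "{..<n}"] by simp
qed

section \<open>The enumerator as a sum over codewords, and the identity\<close>

lemma Z_enum_eq_sum_codewords:
  assumes finC: "finite C" and C: "C \<subseteq> carrier_vec n"
  shows "Z_enum n d C f x y = (\<Sum>u\<in>C. of_real (tilde {..<n} d f (supp u)) *
           (x powi (int n - int (wt u) - int d) * y powi (int (wt u) - int d)))"
proof -
  let ?g = "\<lambda>i. x powi (int n - int i - int d) * y powi (int i - int d)"
  have wt: "wt u \<in> {0..n}" if "u \<in> C" for u
  proof -
    have "supp u \<subseteq> {..<n}" using that C by (auto simp: supp_def)
    then show ?thesis using card_mono[of "{..<n}" "supp u"] by (simp add: wt_def)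
  qed
  have "Z_enum n d C f x y =
      (\<Sum>i\<in>{0..n}. \<Sum>u | u \<in> C \<and> wt u = i. of_real (tilde {..<n} d f (supp u)) * ?g (wt u))"
    by (simp add: Z_enum_def coeff_A_def sum_distrib_right mult.assoc)
  also have "\<dots> = (\<Sum>u\<in>C. of_real (tilde {..<n} d f (supp u)) * ?g (wt u))"
    using finC wt by (intro sum.group) auto
  finally show ?thesis .
qed

text \<open>The matroid of the code is given through an arbitrary generator matrix \<open>G\<close>.
  The conditions \<open>x \<noteq> y\<close> and \<open>y \<noteq> 0\<close> keep the denominators
  in the Tutte arguments nonzero.\<close>

theorem theorem4p4:
  fixes n k d :: nat
    and C :: "'a::{field,finite} vec set"
    and G :: "'a mat"
    and f :: "nat set \<Rightarrow> real"
    and x y :: "'b::real_field"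
  assumes "linear_code n k C"
    and "generator_matrix n k C G"
    and "f \<in> Harm {..<n} d"
    and "x \<noteq> y" and "y \<noteq> 0"
  shows "Z_enum n d C f x y =
    (-1) ^ d * (x - y) powi (int k - int d) * y powi (int n - int k - int d) *
    harmonic_Tutte {..<n} (column_indep G) d f
      ((x + of_nat (card (UNIV :: 'a set) - 1) * y) / (x - y)) (x / y)"
proof -
  let ?E = "{..<n}"
  let ?F = "\<lambda>X. of_real (tilde ?E d f X) :: 'b"
  let ?g = "\<lambda>J. (x - y) powi (int (card J) - int d) * y powi (int n - int (card J) - int d)"
  let ?r = "matroid_rank (column_indep G)"
  let ?q = "of_nat CARD('a) :: 'b"
  let ?X = "(x + of_nat (CARD('a) - 1) * y) / (x - y)"
  have G: "G \<in> carrier_mat k n" using assms(2) by (simp add: generator_matrix_def)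
  have bij: "bij_betw ((*\<^sub>v) G\<^sup>T) (carrier_vec k) C" by (rule generator_matrix_bij_betw[OF assms(2)])
  have C: "C \<subseteq> carrier_vec n" using bij G by (auto simp: bij_betw_def)
  have finC: "finite C" using bij finite_carrier_vec by (metis bij_betw_finite)
  have xy: "x - y \<noteq> 0" using assms(4) by simp
  have codeword: "?F (supp u) * (x powi (int n - int (wt u) - int d) * y powi (int (wt u) - int d)) =
      (-1) ^ d * (\<Sum>J | J \<in> Pow ?E \<and> supp u \<inter> J = {}. ?F J * ?g J)" if u: "u \<in> C" for u
  proof -
    let ?U = "?E - supp u"
    have sub: "supp u \<subseteq> ?E" using u C by (auto simp: supp_def)
    then have "card ?U = n - wt u" and le: "wt u \<le> n"
      using card_mono[OF _ sub] by (simp_all add: card_Diff_subset finite_subset[OF sub] wt_def)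
    then have cU: "int (card ?U) = int n - int (wt u)" by simp
    have "?F ?U = (-1) ^ d * ?F (supp u)"
      using tilde_Diff[OF _ assms(3) sub] by simp
    \<comment> \<open>The sign is its own inverse, so it may change sides.\<close>
    then have "?F (supp u) = (-1) ^ d * ?F ?U"
      by (simp add: power_mult_distrib[symmetric] flip: mult.assoc)
    moreover have "?F ?U * (x powi (int n - int (wt u) - int d) * y powi (int (wt u) - int d)) =
        (\<Sum>J\<in>Pow ?U. ?F J * ?g J)"
      using sum_Pow_tilde[OF _ _ assms(5), of ?E ?U d f x n] unfolding cU by simp
    \<comment> \<open>The subsets of the zero set of \<open>u\<close> are written as a relation
      between \<open>u\<close> and \<open>J\<close>, ready for the exchange of sums.\<close>
    moreover have "Pow ?U = {J. J \<in> Pow ?E \<and> supp u \<inter> J = {}}" by auto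
    ultimately show ?thesis by (simp only: mult.assoc)
  qed
  have "Z_enum n d C f x y =
      (-1) ^ d * (\<Sum>u\<in>C. \<Sum>J | J \<in> Pow ?E \<and> supp u \<inter> J = {}. ?F J * ?g J)"
    unfolding Z_enum_eq_sum_codewords[OF finC C] sum_distrib_left[of "(-1) ^ d" _ C]
    by (intro sum.cong refl codeword)
  also have "(\<Sum>u\<in>C. \<Sum>J | J \<in> Pow ?E \<and> supp u \<inter> J = {}. ?F J * ?g J) =
      (\<Sum>J\<in>Pow ?E. \<Sum>u | u \<in> C \<and> supp u \<inter> J = {}. ?F J * ?g J)"
    using finC by (intro sum.swap_restrict) auto
  \<comment> \<open>The summand is independent of \<open>u\<close>, so the inner sum only counts the
    codewords vanishing on \<open>J\<close>.\<close>
  also have "\<dots> = (\<Sum>J\<in>Pow ?E. ?q ^ (k - ?r J) * (?F J * ?g J))"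
    by (intro sum.cong refl) (simp add: card_codewords_vanishing[OF assms(2)])
  also have "\<dots> = (\<Sum>J\<in>Pow ?E. ((x - y) powi (int k - int d) * y powi (int n - int k - int d)) *
      (?F J * (?X - 1) ^ (k - ?r J) * (x / y - 1) ^ (card J - ?r J)))"
  proof (rule sum.cong[OF refl])
    fix J assume "J \<in> Pow ?E"
    then have rk: "?r J \<le> k" and rJ: "?r J \<le> card J"
      using card_orthogonal_columns(2,3)[OF G] by auto
    \<comment> \<open>Here \<open>a\<close> and \<open>b\<close> are the two Tutte exponents of
      \<open>J\<close>, its corank and nullity, and \<open>card J = k - a + b\<close>.\<close>
    obtain a where a: "k = ?r J + a" using rk le_Suc_ex by blast
    obtain b where b: "card J = ?r J + b" using rJ le_Suc_ex by blast
    have "?X - 1 = ?q * y / (x - y)"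
      using xy by (simp add: field_simps of_nat_diff)
    moreover have "x / y - 1 = (x - y) / y" using assms(5) by (simp add: field_simps)
    \<comment> \<open>Replacing \<open>card J\<close> by \<open>k\<close> in the exponents costs
      \<open>b - a\<close> for \<open>x - y\<close> and \<open>a - b\<close> for \<open>y\<close>.
      The remaining \<open>?q ^ a\<close> joins the first quotient to form the power of
      \<open>?X - 1\<close>.\<close>
    moreover have "?g J = (x - y) powi (int k - int d) * y powi (int n - int k - int d) *
        ((y / (x - y)) ^ a * ((x - y) / y) ^ b)"
    proof -
      have "(x - y) powi (int (card J) - int d) = (x - y) powi (int k - int d) * (x - y) ^ b / (x - y) ^ a"
        using xy by (simp add: a b power_int_add power_int_diff field_simps)
      moreover have "y powi (int n - int (card J) - int d) = y powi (int n - int k - int d) * y ^ a / y ^ b"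
        using assms(5) by (simp add: a b power_int_add power_int_diff field_simps)
      ultimately show ?thesis by (simp add: power_divide)
    qed
    ultimately show "?q ^ (k - ?r J) * (?F J * ?g J) =
        ((x - y) powi (int k - int d) * y powi (int n - int k - int d)) *
        (?F J * (?X - 1) ^ (k - ?r J) * (x / y - 1) ^ (card J - ?r J))"
      using a b by (simp add: power_mult_distrib power_divide)
  qed
  also have "\<dots> = (x - y) powi (int k - int d) * y powi (int n - int k - int d) *
      harmonic_Tutte ?E (column_indep G) d f ?X (x / y)"
    unfolding harmonic_Tutte_def matroid_rank_generator_matrix[OF assms(2)]
    by (simp only: sum_distrib_left)
  finally show ?thesis by (simp only: mult.assoc)
qed

end
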